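(* Let $R$ be a rotational surface in $\mathbb{E}^3$ given by $\Phi(s,\theta)=(f(s)\cos\theta,f(s)\sin\theta,g(s))$ with $f'^2+g'^2=1$, and let $$\alpha(t)=\big(f(s(t))\cos\theta(t),\ f(s(t))\sin\theta(t),\ g(s(t))\big),\quad s(t)=(\cos\psi)t+c,\quad \theta(t)=\varepsilon\sin\psi\int_{t_0}^{t}\frac{d\xi}{f(s(\xi))}$$ be a loxodrome on $R$, where $\psi\in[0,\pi]$, $\varepsilon=\pm1$, and $c,t_0$ are constants. If $R$ is flat, then $\alpha$ is a general helix.
   Context: $f,g$ are smooth functions on an open interval and $\Phi$ is an immersion (so $f$ is nowhere zero). The Gaussian curvature of $R$ is $K=-f''/f$; $R$ is flat if $K=0$ identically. A unit speed curve $\alpha$ with unit tangent $T$ is a general helix if there is a fixed unit vector $u$ such that $\langle T,u\rangle$ is constant. *)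

theory Defs
  imports "HOL-Analysis.Analysis"
begin

text \<open>Only meaningful for open \<open>S\<close>, where the iterated derivatives at a point of \<open>S\<close> do not
  depend on the values of \<open>f\<close> outside \<open>S\<close>.\<close>

definition smooth_on :: "(real \<Rightarrow> 'a::real_normed_vector) \<Rightarrow> real set \<Rightarrow> bool" where
  "smooth_on f S \<longleftrightarrow>
     (\<forall>n. \<forall>t\<in>S. ((\<lambda>h x. vector_derivative h (at x)) ^^ n) f differentiable at t)"

definition immersion_on :: "(real \<times> real \<Rightarrow> real^3) \<Rightarrow> (real \<times> real) set \<Rightarrow> bool" where
  "immersion_on X D \<longleftrightarrow>
     (\<forall>p\<in>D. X differentiable at p \<and> inj (frechet_derivative X (at p)))"

definition rotational_surface :: "(real \<Rightarrow> real) \<Rightarrow> (real \<Rightarrow> real) \<Rightarrow> real \<times> real \<Rightarrow> real^3" where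
  "rotational_surface f g = (\<lambda>(s, \<theta>). vector [f s * cos \<theta>, f s * sin \<theta>, g s])"

definition dir_deriv :: "real \<times> real \<Rightarrow> (real \<times> real \<Rightarrow> real^3) \<Rightarrow> real \<times> real \<Rightarrow> real^3" where
  "dir_deriv v X p = frechet_derivative X (at p) v"

abbreviation "partial1 \<equiv> dir_deriv (1, 0)"
abbreviation "partial2 \<equiv> dir_deriv (0, 1)"

definition unit_normal :: "(real \<times> real \<Rightarrow> real^3) \<Rightarrow> real \<times> real \<Rightarrow> real^3" where
  "unit_normal X p = sgn (cross3 (partial1 X p) (partial2 X p))"

definition gaussian_curvature :: "(real \<times> real \<Rightarrow> real^3) \<Rightarrow> real \<times> real \<Rightarrow> real" where
  "gaussian_curvature X p =
    (let E = partial1 X p \<bullet> partial1 X p;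
         F = partial1 X p \<bullet> partial2 X p;
         G = partial2 X p \<bullet> partial2 X p;
         L = partial1 (partial1 X) p \<bullet> unit_normal X p;
         M = partial2 (partial1 X) p \<bullet> unit_normal X p;
         N = partial2 (partial2 X) p \<bullet> unit_normal X p
     in (L * N - M\<^sup>2) / (E * G - F\<^sup>2))"

definition flat_on :: "(real \<times> real \<Rightarrow> real^3) \<Rightarrow> (real \<times> real) set \<Rightarrow> bool" where
  "flat_on X D \<longleftrightarrow> (\<forall>p\<in>D. gaussian_curvature X p = 0)"

definition general_helix_on :: "(real \<Rightarrow> real^3) \<Rightarrow> real set \<Rightarrow> bool" where
  "general_helix_on \<alpha> J \<longleftrightarrow>
     smooth_on \<alpha> J \<and>
     (\<forall>t\<in>J. norm (vector_derivative \<alpha> (at t)) = 1) \<and>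
     (\<exists>u. norm u = 1 \<and> (\<exists>k. \<forall>t\<in>J. vector_derivative \<alpha> (at t) \<bullet> u = k))"

lemma smooth_on_real_derivs:
  fixes f :: "real \<Rightarrow> real"
  assumes "smooth_on f S" "t \<in> S"
  shows "(f has_real_derivative deriv f t) (at t)"
    and "(deriv f has_real_derivative deriv (deriv f) t) (at t)"
proof -
  have "f differentiable at t"
    using assms unfolding smooth_on_def by (auto dest!: spec[of _ 0])
  then show "(f has_real_derivative deriv f t) (at t)"
    using DERIV_deriv_iff_real_differentiable by blast
  have "(\<lambda>x. vector_derivative f (at x)) differentiable at t"
    using assms unfolding smooth_on_def by (auto dest!: spec[of _ 1])
  then have "deriv f differentiable at t"
    by (simp add: field_derivative_eq_vector_derivative[abs_def])
  then show "(deriv f has_real_derivative deriv (deriv f) t) (at t)"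
    using DERIV_deriv_iff_real_differentiable by blast
qed

lemma has_derivative_vector3:
  fixes a b c :: "real \<times> real \<Rightarrow> real"
  assumes "(a has_derivative a') F" "(b has_derivative b') F" "(c has_derivative c') F"
  shows "((\<lambda>p. vector [a p, b p, c p] :: real^3) has_derivative
          (\<lambda>h. vector [a' h, b' h, c' h])) F"
proof -
  have eq: "(vector [x, y, z] :: real^3) = x *\<^sub>R axis 1 1 + y *\<^sub>R axis 2 1 + z *\<^sub>R axis 3 1"
    for x y z :: real
    by (simp add: vec_eq_iff forall_3 axis_def)
  show ?thesis
    unfolding eq by (intro derivative_intros assms)
qed

lemma dir_deriv_vector3:
  fixes a c u v :: "real \<Rightarrow> real"
  assumes a: "(a has_real_derivative a') (at s)" and c: "(c has_real_derivative c') (at s)"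
    and u: "(u has_real_derivative u') (at \<theta>)" and v: "(v has_real_derivative v') (at \<theta>)"
  shows "dir_deriv w (\<lambda>p. vector [a (fst p) * u (snd p), a (fst p) * v (snd p), c (fst p)]) (s, \<theta>) =
    vector [a s * (snd w * u') + fst w * a' * u \<theta>, a s * (snd w * v') + fst w * a' * v \<theta>, fst w * c']"
proof -
  have 1: "((\<lambda>p. h (fst p)) has_derivative (\<lambda>w. fst w * h')) (at (s, \<theta>))"
    if "(h has_real_derivative h') (at s)" for h h'
    using DERIV_compose_FDERIV[of h h' fst "(s, \<theta>)" fst UNIV] that
    by (simp add: has_derivative_fst)
  have 2: "((\<lambda>p. h (snd p)) has_derivative (\<lambda>w. snd w * h')) (at (s, \<theta>))"
    if "(h has_real_derivative h') (at \<theta>)" for h h'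
    using DERIV_compose_FDERIV[of h h' snd "(s, \<theta>)" snd UNIV] that
    by (simp add: has_derivative_snd)
  show ?thesis
    unfolding dir_deriv_def
    by (subst frechet_derivative_at[symmetric, OF has_derivative_vector3[OF
          has_derivative_mult[OF 1[OF a] 2[OF u]] has_derivative_mult[OF 1[OF a] 2[OF v]] 1[OF c]]])
      simp
qed

lemma dir_deriv_cong_open:
  assumes "open D" "p \<in> D" "\<And>q. q \<in> D \<Longrightarrow> X q = Y q"
  shows "dir_deriv v X p = dir_deriv v Y p"
proof -
  have "(X has_derivative X') (at p) \<longleftrightarrow> (Y has_derivative X') (at p)" for X'
    using has_derivative_transform_within_open[of X X' p UNIV D Y]
      has_derivative_transform_within_open[of Y X' p UNIV D X] assms by auto
  then show ?thesis
    by (simp add: dir_deriv_def frechet_derivative_def)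
qed

lemma gaussian_curvature_rotational_surface:
  assumes "open I" "s \<in> I" and sm: "smooth_on f I" "smooth_on g I"
    and unit: "\<And>s. s \<in> I \<Longrightarrow> (deriv f s)\<^sup>2 + (deriv g s)\<^sup>2 = 1"
    and f0: "f s \<noteq> 0"
  shows "gaussian_curvature (rotational_surface f g) (s, \<theta>) = - deriv (deriv f) s / f s"
proof -
  let ?X = "rotational_surface f g"
  let ?D = "I \<times> (UNIV :: real set)"
  have D: "open ?D" "(s, \<theta>) \<in> ?D"
    using assms by (auto intro: open_Times)
  note df = smooth_on_real_derivs[OF sm(1)] and dg = smooth_on_real_derivs[OF sm(2)]
  have X: "?X = (\<lambda>p. vector [f (fst p) * cos (snd p), f (fst p) * sin (snd p), g (fst p)])"
    by (auto simp: rotational_surface_def fun_eq_iff)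
  define X1 :: "real \<times> real \<Rightarrow> real^3" where "X1 = (\<lambda>p. vector
    [deriv f (fst p) * cos (snd p), deriv f (fst p) * sin (snd p), deriv g (fst p)])"
  define X2 :: "real \<times> real \<Rightarrow> real^3" where "X2 = (\<lambda>p. vector
    [f (fst p) * - sin (snd p), f (fst p) * cos (snd p), 0])"
  have dcos: "(cos has_real_derivative - sin x) (at x)"
    and dsin: "(sin has_real_derivative cos x) (at x)"
    and dmsin: "((\<lambda>x. - sin x) has_real_derivative - cos x) (at x)" for x :: real
    by (auto intro!: derivative_eq_intros)
  have X12: "partial1 ?X p = X1 p" "partial2 ?X p = X2 p" if "p \<in> ?D" for p
  proof -
    obtain x y where p: "p = (x, y)" "x \<in> I" using \<open>p \<in> ?D\<close> by auto
    show "partial1 ?X p = X1 p" "partial2 ?X p = X2 p"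
      unfolding X p(1) X1_def X2_def dir_deriv_vector3[OF df(1)[OF p(2)] dg(1)[OF p(2)] dcos dsin]
      by simp_all
  qed
  note d2 = dir_deriv_vector3[OF df(2)[OF \<open>s \<in> I\<close>] dg(2)[OF \<open>s \<in> I\<close>] dcos dsin]
  have X11: "partial1 (partial1 ?X) (s, \<theta>) =
      vector [deriv (deriv f) s * cos \<theta>, deriv (deriv f) s * sin \<theta>, deriv (deriv g) s]"
    using dir_deriv_cong_open[OF D X12(1)] unfolding X1_def by (simp add: d2)
  have X21: "partial2 (partial1 ?X) (s, \<theta>) =
      vector [- (deriv f s * sin \<theta>), deriv f s * cos \<theta>, 0]"
    using dir_deriv_cong_open[OF D X12(1)] unfolding X1_def by (simp add: d2)
  have X22: "partial2 (partial2 ?X) (s, \<theta>) = vector [- (f s * cos \<theta>), - (f s * sin \<theta>), 0]"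
    using dir_deriv_cong_open[OF D X12(2)]
      dir_deriv_vector3[OF df(1)[OF \<open>s \<in> I\<close>] DERIV_const[of 0] dmsin dcos, of "(0, 1)"]
    unfolding X2_def by simp
  define k where "k = sgn (f s)"
  have k: "k * k = 1" "\<bar>f s\<bar> = k * f s" "k \<noteq> 0"
    using f0 by (auto simp: k_def sgn_if)
  have cr: "cross3 (X1 (s, \<theta>)) (X2 (s, \<theta>)) =
      f s *\<^sub>R vector [- deriv g s * cos \<theta>, - deriv g s * sin \<theta>, deriv f s]" (is "_ = _ *\<^sub>R ?n")
  proof -
    have "deriv f s * cos \<theta> * (f s * cos \<theta>) + deriv f s * sin \<theta> * (f s * sin \<theta>)
        = f s * deriv f s * ((sin \<theta>)\<^sup>2 + (cos \<theta>)\<^sup>2)"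
      by algebra
    then show ?thesis
      by (simp add: X1_def X2_def cross3_def vec_eq_iff forall_3)
  qed
  have "?n \<bullet> ?n = ((deriv g s)\<^sup>2 * ((sin \<theta>)\<^sup>2 + (cos \<theta>)\<^sup>2)) + (deriv f s)\<^sup>2"
    unfolding inner_vec_def by (simp add: sum_3) (use sin_cos_squared_add[of \<theta>] in algebra)
  then have "norm ?n = 1"
    using unit[OF \<open>s \<in> I\<close>] by (simp add: norm_eq_sqrt_inner add.commute)
  then have n: "unit_normal ?X (s, \<theta>) = k *\<^sub>R ?n"
    using f0 D by (simp add: unit_normal_def X12 cr sgn_scaleR k_def sgn_div_norm)
  have E: "X1 (s, \<theta>) \<bullet> X1 (s, \<theta>) = 1"
  proof -
    have "X1 (s, \<theta>) \<bullet> X1 (s, \<theta>) = (deriv f s)\<^sup>2 * ((sin \<theta>)\<^sup>2 + (cos \<theta>)\<^sup>2) + (deriv g s)\<^sup>2"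
      unfolding inner_vec_def by (simp add: sum_3 X1_def) (use sin_cos_squared_add[of \<theta>] in algebra)
    then show ?thesis using unit[OF \<open>s \<in> I\<close>] by simp
  qed
  have F: "X1 (s, \<theta>) \<bullet> X2 (s, \<theta>) = 0"
    unfolding inner_vec_def by (simp add: sum_3 X1_def X2_def)
  have G: "X2 (s, \<theta>) \<bullet> X2 (s, \<theta>) = (f s)\<^sup>2"
  proof -
    have "X2 (s, \<theta>) \<bullet> X2 (s, \<theta>) = (f s)\<^sup>2 * ((sin \<theta>)\<^sup>2 + (cos \<theta>)\<^sup>2)"
      unfolding inner_vec_def by (simp add: sum_3 X2_def) (use sin_cos_squared_add[of \<theta>] in algebra)
    then show ?thesis by simp
  qed
  let ?f1 = "deriv f s" and ?f2 = "deriv (deriv f) s"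
  let ?g1 = "deriv g s" and ?g2 = "deriv (deriv g) s"
  have L: "partial1 (partial1 ?X) (s, \<theta>) \<bullet> unit_normal ?X (s, \<theta>) = k * (?f1 * ?g2 - ?f2 * ?g1)"
  proof -
    have "partial1 (partial1 ?X) (s, \<theta>) \<bullet> unit_normal ?X (s, \<theta>)
        = k * (?f1 * ?g2 - ?f2 * ?g1 * ((sin \<theta>)\<^sup>2 + (cos \<theta>)\<^sup>2))"
      unfolding inner_vec_def X11 n by (simp add: sum_3) (use sin_cos_squared_add[of \<theta>] in algebra)
    then show ?thesis by simp
  qed
  have M: "partial2 (partial1 ?X) (s, \<theta>) \<bullet> unit_normal ?X (s, \<theta>) = 0"
    unfolding inner_vec_def X21 n by (simp add: sum_3)
  have N: "partial2 (partial2 ?X) (s, \<theta>) \<bullet> unit_normal ?X (s, \<theta>) = k * f s * ?g1"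
  proof -
    have "partial2 (partial2 ?X) (s, \<theta>) \<bullet> unit_normal ?X (s, \<theta>)
        = k * f s * ?g1 * ((sin \<theta>)\<^sup>2 + (cos \<theta>)\<^sup>2)"
      unfolding inner_vec_def X22 n by (simp add: sum_3) (use sin_cos_squared_add[of \<theta>] in algebra)
    then show ?thesis by simp
  qed
  have "((\<lambda>x. (deriv f x)\<^sup>2 + (deriv g x)\<^sup>2) has_real_derivative 2 * ?f1 * ?f2 + 2 * ?g1 * ?g2) (at s)"
    using assms by (auto intro!: derivative_eq_intros df dg)
  moreover have "((\<lambda>x. (deriv f x)\<^sup>2 + (deriv g x)\<^sup>2) has_real_derivative 0) (at s)"
    by (rule has_field_derivative_transform_within_open[of "\<lambda>_. 1" 0 s I])
      (use assms in auto)
  ultimately have fg: "?f1 * ?f2 + ?g1 * ?g2 = 0"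
    using DERIV_unique by fastforce
  have "gaussian_curvature ?X (s, \<theta>) = (k * (?f1 * ?g2 - ?f2 * ?g1) * (k * f s * ?g1)) / (f s)\<^sup>2"
    using D by (simp add: gaussian_curvature_def X12 E F G L M N)
  also have "k * (?f1 * ?g2 - ?f2 * ?g1) * (k * f s * ?g1) = - ?f2 * f s"
    using k(1) fg unit[OF \<open>s \<in> I\<close>] by algebra
  finally show ?thesis
    using f0 by (simp add: power2_eq_square)
qed

end

(* Vanishing curvature forces f'' = 0, so on the interval I both f' and g' are constant (the profile
   curve is a straight line segment). The third component of the tangent of a loxodrome is
   g' (s t) * cos psi, so the axis e_3 works. *)
theory Submission
  imports Defs
begin

text \<open>A class \<open>P\<close> closed under differentiation contains every iterated derivative
  of its members, by induction on the order. Smoothness thus follows without a formula for the n-th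
  derivative.\<close>

lemma smooth_on_invariant:
  assumes "P h"
    and "\<And>h t. P h \<Longrightarrow> t \<in> S \<Longrightarrow> h differentiable at t"
    and "\<And>h. P h \<Longrightarrow> P (\<lambda>x. vector_derivative h (at x))"
  shows "smooth_on h S"
proof -
  have "P (((\<lambda>h x. vector_derivative h (at x)) ^^ n) h)" for n
    by (induction n) (use assms in auto)
  then show ?thesis
    unfolding smooth_on_def using assms(2) by blast
qed

text \<open>Since r' is constant and \<theta>' is a multiple of 1/r, differentiating a combination
  of cos \<theta> and sin \<theta> with fixed vector coefficients only produces further powers of
  1/r. The shape is imposed on the derivative of \<open>h\<close> because a loxodrome, with
  coordinates r cos \<theta> and r sin \<theta>, in general acquires it only after one
  differentiation.\<close>

lemma smooth_on_closed_form:
  fixes r \<theta> :: "real \<Rightarrow> real" and h :: "real \<Rightarrow> 'a::real_normed_vector"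
  assumes S: "open S"
    and r0: "\<And>t. t \<in> S \<Longrightarrow> r t \<noteq> 0"
    and r: "\<And>t. t \<in> S \<Longrightarrow> (r has_real_derivative p) (at t)"
    and \<theta>: "\<And>t. t \<in> S \<Longrightarrow> (\<theta> has_real_derivative k / r t) (at t)"
    and h: "\<And>t. t \<in> S \<Longrightarrow>
      (h has_vector_derivative cos (\<theta> t) *\<^sub>R A + sin (\<theta> t) *\<^sub>R B + C) (at t)"
  shows "smooth_on h S"
proof -
  \<comment> \<open>The derivatives of all orders \<open>\<ge> 1\<close> stay in this family.\<close>
  define Q where "Q h \<longleftrightarrow> (\<exists>n A B C. \<forall>t\<in>S. h t =
      inverse (r t) ^ n *\<^sub>R (cos (\<theta> t) *\<^sub>R A + sin (\<theta> t) *\<^sub>R B + C))" for h :: "real \<Rightarrow> 'a"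
  have Q: "\<exists>h'. Q h' \<and> (\<forall>t\<in>S. (h has_vector_derivative h' t) (at t))" if Qh: "Q h" for h
  proof -
    obtain n A B C where eq: "\<And>t. t \<in> S \<Longrightarrow>
        h t = inverse (r t) ^ n *\<^sub>R (cos (\<theta> t) *\<^sub>R A + sin (\<theta> t) *\<^sub>R B + C)"
      using Qh unfolding Q_def by blast
    \<comment> \<open>Product rule: differentiating the power of 1/r gives the terms with n p, and
      turning by \<theta>' = k/r sends \<open>A\<close> to \<open>B\<close> and \<open>B\<close> to
      \<open>-A\<close> with weight k. Both contributions carry the same factor 1/r, so the exponent
      rises by exactly one.\<close>
    define h' where "h' t = inverse (r t) ^ Suc n *\<^sub>R (cos (\<theta> t) *\<^sub>R (k *\<^sub>R B - (n * p) *\<^sub>R A)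
        + sin (\<theta> t) *\<^sub>R (- k *\<^sub>R A - (n * p) *\<^sub>R B) + (- n * p) *\<^sub>R C)" for t
    have "(h has_vector_derivative h' t) (at t)" if t: "t \<in> S" for t
    proof (rule has_vector_derivative_transform_within_open[OF _ S t eq[symmetric]])
      \<comment> \<open>The power rule yields the exponent \<open>n - 1\<close> with truncated
        subtraction, so n = 0 is checked separately.\<close>
      have i: "((\<lambda>t. inverse (r t) ^ n) has_real_derivative
          - (n * p) * inverse (r t) ^ Suc n) (at t)"
        using DERIV_power[OF DERIV_inverse_fun[OF r[OF t] r0[OF t]], of n]
        by (cases n) (simp_all add: algebra_simps)
      have c: "((\<lambda>t. cos (\<theta> t)) has_real_derivative - sin (\<theta> t) * (k * inverse (r t))) (at t)"
        and s: "((\<lambda>t. sin (\<theta> t)) has_real_derivative cos (\<theta> t) * (k * inverse (r t))) (at t)"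
        by (auto intro!: derivative_eq_intros \<theta>[OF t] simp: field_simps)
      show "((\<lambda>t. inverse (r t) ^ n *\<^sub>R (cos (\<theta> t) *\<^sub>R A + sin (\<theta> t) *\<^sub>R B + C))
          has_vector_derivative h' t) (at t)"
        by (rule derivative_eq_intros i c s refl)+ (simp add: h'_def algebra_simps)
    qed auto
    moreover have "Q h'"
      unfolding Q_def h'_def by blast
    ultimately show ?thesis
      by blast
  qed
  \<comment> \<open>\<open>Q\<close> depends only on values on \<open>S\<close>, and off
    \<open>S\<close> nothing is known about \<open>vector_derivative\<close>.\<close>
  have cong: "Q h'" if "Q h''" "\<And>t. t \<in> S \<Longrightarrow> h' t = h'' t" for h' h''
    using that unfolding Q_def by metis
  \<comment> \<open>The invariant is having a derivative in \<open>Q\<close>, not lying in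
    \<open>Q\<close>, so that it can also hold for \<open>h\<close> itself.\<close>
  define P where "P h \<longleftrightarrow> (\<exists>h'. Q h' \<and> (\<forall>t\<in>S. (h has_vector_derivative h' t) (at t)))"
    for h :: "real \<Rightarrow> 'a"
  show ?thesis
  proof (rule smooth_on_invariant[of P])
    have "Q (\<lambda>t. cos (\<theta> t) *\<^sub>R A + sin (\<theta> t) *\<^sub>R B + C)"
      unfolding Q_def by (intro exI[of _ 0] exI[of _ A] exI[of _ B] exI[of _ C]) simp
    then show "P h"
      unfolding P_def using h by blast
  next
    fix h t assume "P h" "t \<in> S"
    then show "h differentiable at t"
      unfolding P_def using differentiableI_vector by blast
  next
    fix h assume "P h"
    then obtain h' where h': "Q h'" "\<And>t. t \<in> S \<Longrightarrow> (h has_vector_derivative h' t) (at t)"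
      unfolding P_def by blast
    have "Q (\<lambda>x. vector_derivative h (at x))"
      by (rule cong[OF h'(1)]) (use h'(2) vector_derivative_at in blast)
    then show "P (\<lambda>x. vector_derivative h (at x))"
      unfolding P_def by (rule Q)
  qed
qed

text \<open>Where the profile meets the axis its parallel circle shrinks to a point, so the
  differential kills the direction (0, 1) and cannot be injective.\<close>

lemma immersion_rotational_surface_nonzero:
  assumes "immersion_on (rotational_surface f g) (I \<times> UNIV)"
    and sm: "smooth_on f I" "smooth_on g I" and x: "x \<in> I"
  shows "f x \<noteq> 0"
proof
  assume "f x = 0"
  let ?D = "frechet_derivative (rotational_surface f g) (at (x, 0))"
  have X: "rotational_surface f g =
      (\<lambda>p. vector [f (fst p) * cos (snd p), f (fst p) * sin (snd p), g (fst p)])"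
    by (auto simp: rotational_surface_def fun_eq_iff)
  have "dir_deriv w (rotational_surface f g) (x, 0) = vector [f x * (snd w * - sin 0) + fst w * deriv f x * cos 0,
      f x * (snd w * cos 0) + fst w * deriv f x * sin 0, fst w * deriv g x]" for w
    unfolding X by (rule dir_deriv_vector3[OF smooth_on_real_derivs(1)[OF sm(1) x]
          smooth_on_real_derivs(1)[OF sm(2) x]]) (auto intro!: derivative_eq_intros)
  then have "?D (0, 1) = ?D (0, 0)"
    using \<open>f x = 0\<close> by (simp add: dir_deriv_def)
  moreover have "inj ?D"
    using assms(1) x by (auto simp: immersion_on_def)
  ultimately show False
    by (auto dest: injD)
qed

text \<open>From K = -f''/f one gets f'' = 0, hence f' is a constant a on the interval. Arc length
  then fixes only the square of g'; that its sign cannot change comes from showing g'' = 0 as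
  well.\<close>

lemma flat_rotational_surface_profile:
  assumes I: "open I" "is_interval I" and sm: "smooth_on f I" "smooth_on g I"
    and unit: "\<And>x. x \<in> I \<Longrightarrow> (deriv f x)\<^sup>2 + (deriv g x)\<^sup>2 = 1"
    and f0: "\<And>x. x \<in> I \<Longrightarrow> f x \<noteq> 0"
    and flat: "flat_on (rotational_surface f g) (I \<times> UNIV)"
  shows "\<exists>a b. \<forall>x\<in>I. deriv f x = a \<and> deriv g x = b"
proof -
  note df = smooth_on_real_derivs[OF sm(1)] and dg = smooth_on_real_derivs[OF sm(2)]
  have conv: "convex I"
    using I(2) is_interval_convex_1 by blast
  have f2: "deriv (deriv f) x = 0" if x: "x \<in> I" for x
  proof -
    have "gaussian_curvature (rotational_surface f g) (x, 0) = 0"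
      using flat x by (auto simp: flat_on_def)
    then show ?thesis
      using gaussian_curvature_rotational_surface[OF I(1) x sm unit f0[OF x]] f0[OF x] by simp
  qed
  have "\<exists>a. \<forall>x\<in>I. deriv f x = a"
    by (rule has_field_derivative_zero_constant[OF conv])
      (metis df(2) f2 has_field_derivative_at_within)
  then obtain a where a: "\<And>x. x \<in> I \<Longrightarrow> deriv f x = a" by blast
  then have g1: "(deriv g x)\<^sup>2 = 1 - a\<^sup>2" if "x \<in> I" for x
    using unit[OF that] that by simp
  have "\<exists>b. \<forall>x\<in>I. deriv g x = b"
  proof (rule has_field_derivative_zero_constant[OF conv])
    fix x assume x: "x \<in> I"
    have "((\<lambda>x. (deriv g x)\<^sup>2) has_real_derivative 2 * deriv g x * deriv (deriv g) x) (at x)"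
      by (auto intro!: derivative_eq_intros dg x)
    moreover have "((\<lambda>x. (deriv g x)\<^sup>2) has_real_derivative 0) (at x)"
      by (rule has_field_derivative_transform_within_open[of "\<lambda>_. 1 - a\<^sup>2" 0 x I]) (use I x g1 in auto)
    ultimately have z: "deriv g x * deriv (deriv g) x = 0"
      using DERIV_unique by fastforce
    \<comment> \<open>Where g' is nonzero it cancels from g' g'' = 0. If it vanishes at
      \<open>x\<close>, then 1 - a^2 = 0, so g' vanishes on all of \<open>I\<close>: this is the
      planar case.\<close>
    have "(deriv g has_real_derivative 0) (at x)"
    proof (cases "deriv g x = 0")
      case True
      then have "deriv g y = 0" if "y \<in> I" for y
        using g1[OF x] g1[OF that] by simp
      then show ?thesis
        using has_field_derivative_transform_within_open[OF DERIV_const[of 0] I(1) x, of "deriv g"] by simp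
    next
      case False
      then show ?thesis using z dg(2)[OF x] by simp
    qed
    then show "(deriv g has_real_derivative 0) (at x within I)"
      by (rule has_field_derivative_at_within)
  qed
  then show ?thesis
    using a by blast
qed

text \<open>The fundamental theorem of calculus on a compact interval gives a derivative within that
  interval; placing \<open>t\<close> in its interior makes it two-sided. The point \<open>t\<close>
  may lie on either side of the base point.\<close>

lemma interval_integral_has_real_derivative:
  fixes h :: "real \<Rightarrow> real"
  assumes J: "open J" "is_interval J" "t\<^sub>0 \<in> J" "t \<in> J" and h: "continuous_on J h"
  shows "((\<lambda>t. LBINT \<xi>=t\<^sub>0..t. h \<xi>) has_real_derivative h t) (at t)"
proof -
  obtain e where e: "e > 0" "cball t e \<subseteq> J"
    using J open_contains_cball by blast
  \<comment> \<open>The interval must contain the base point and have \<open>t\<close> strictly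
    inside, yet stay within \<open>J\<close>.\<close>
  define a b where "a = min t\<^sub>0 (t - e)" and "b = max t\<^sub>0 (t + e)"
  have ab: "a \<in> J" "b \<in> J" "a < t" "t < b" "a \<le> t\<^sub>0" "t\<^sub>0 \<le> b"
    using e J(3) by (auto simp: a_def b_def min_def max_def cball_def dist_real_def subset_iff)
  have "{a..b} \<subseteq> J"
    using J(2) ab(1,2) mem_is_interval_1_I by (metis atLeastAtMost_iff subsetI)
  then have "((\<lambda>u. LBINT \<xi>=t\<^sub>0..u. h \<xi>) has_vector_derivative h t) (at t within {a..b})"
    using ab h by (intro interval_integral_FTC2) (auto intro: continuous_on_subset)
  then have "((\<lambda>u. LBINT \<xi>=t\<^sub>0..u. h \<xi>) has_vector_derivative h t) (at t)"
    using ab at_within_interior[of t "{a..b}"] by simp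
  then show ?thesis
    by (simp add: has_real_derivative_iff_has_vector_derivative)
qed

theorem theorem4:
  fixes f g s \<theta> :: "real \<Rightarrow> real" and \<alpha> :: "real \<Rightarrow> real^3"
    and I J :: "real set" and \<psi> \<epsilon> c t\<^sub>0 :: real
  assumes I: "open I" "is_interval I"
    and smooth: "smooth_on f I" "smooth_on g I"
    and arclength: "\<And>x. x \<in> I \<Longrightarrow> (deriv f x)\<^sup>2 + (deriv g x)\<^sup>2 = 1"
    and immersion: "immersion_on (rotational_surface f g) (I \<times> UNIV)"
    and J: "open J" "is_interval J" "t\<^sub>0 \<in> J"
    and \<psi>: "0 \<le> \<psi>" "\<psi> \<le> pi"
    and \<epsilon>: "\<epsilon> = 1 \<or> \<epsilon> = -1"
    and s: "s = (\<lambda>t. cos \<psi> * t + c)" "s ` J \<subseteq> I"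
    and \<theta>: "\<theta> = (\<lambda>t. \<epsilon> * sin \<psi> * (LBINT \<xi>=t\<^sub>0..t. 1 / f (s \<xi>)))"
    and \<alpha>: "\<alpha> = (\<lambda>t. vector [f (s t) * cos (\<theta> t), f (s t) * sin (\<theta> t), g (s t)])"
    and flat: "flat_on (rotational_surface f g) (I \<times> UNIV)"
  shows "general_helix_on \<alpha> J"
proof -
  note df = smooth_on_real_derivs(1)[OF smooth(1)] and dg = smooth_on_real_derivs(1)[OF smooth(2)]
  have f0: "\<And>x. x \<in> I \<Longrightarrow> f x \<noteq> 0"
    using immersion_rotational_surface_nonzero[OF immersion smooth] .
  obtain a b where a: "\<And>x. x \<in> I \<Longrightarrow> deriv f x = a" and b: "\<And>x. x \<in> I \<Longrightarrow> deriv g x = b"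
    using flat_rotational_surface_profile[OF I smooth arclength f0 flat] by blast
  \<comment> \<open>The base point of the integral supplies a point of \<open>J\<close>, and hence
    of \<open>I\<close>, at which arc length can be evaluated.\<close>
  have ab: "a\<^sup>2 + b\<^sup>2 = 1"
    using arclength[of "s t\<^sub>0"] a b s(2) J(3) by auto
  define k where "k = \<epsilon> * sin \<psi>"
  define p where "p = a * cos \<psi>"
  define r where "r = (\<lambda>t. f (s t))"
  define e :: "3 \<Rightarrow> real^3" where "e = (\<lambda>i. axis i 1)"
  have sI: "s t \<in> I" if "t \<in> J" for t
    using s(2) that by blast
  have ds: "(s has_real_derivative cos \<psi>) (at t)" for t
    unfolding s(1) by (auto intro!: derivative_eq_intros)
  have r: "(r has_real_derivative p) (at t)" if "t \<in> J" for t
    using DERIV_chain2[OF df[OF sI[OF that]] ds] a[OF sI[OF that]] by (simp add: r_def p_def)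
  have z: "((\<lambda>t. g (s t)) has_real_derivative b * cos \<psi>) (at t)" if "t \<in> J" for t
    using DERIV_chain2[OF dg[OF sI[OF that]] ds] b[OF sI[OF that]] by simp
  have r0: "r t \<noteq> 0" if "t \<in> J" for t
    using f0 sI that by (simp add: r_def)
  have "continuous_on J (\<lambda>t. 1 / r t)"
    using r r0 by (intro continuous_intros) (auto intro!: continuous_at_imp_continuous_on DERIV_isCont)
  then have d\<theta>: "(\<theta> has_real_derivative k / r t) (at t)" if "t \<in> J" for t
    using DERIV_cmult[OF interval_integral_has_real_derivative[OF J that], of "\<lambda>t. 1 / r t" k]
    by (simp add: \<theta> k_def r_def)
  have \<alpha>e: "\<alpha> = (\<lambda>t. (r t * cos (\<theta> t)) *\<^sub>R e 1 + (r t * sin (\<theta> t)) *\<^sub>R e 2 + g (s t) *\<^sub>R e 3)"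
    by (simp add: \<alpha> r_def e_def fun_eq_iff vec_eq_iff forall_3 axis_def)
  \<comment> \<open>The tangent has radial component p, component r \<theta>' = k along the
    parallel, and constant axial component. Sorting the first two by cos \<theta> and sin \<theta>
    gives \<open>A\<close> and \<open>B\<close>; the axial part is \<open>C\<close>.\<close>
  define A B C where "A = p *\<^sub>R e 1 + k *\<^sub>R e 2" and "B = p *\<^sub>R e 2 - k *\<^sub>R e 1"
    and "C = (b * cos \<psi>) *\<^sub>R e 3"
  define T where "T t = cos (\<theta> t) *\<^sub>R A + sin (\<theta> t) *\<^sub>R B + C" for t
  have d\<alpha>: "(\<alpha> has_vector_derivative T t) (at t)" if t: "t \<in> J" for t
  proof -
    have 1: "((\<lambda>t. r t * cos (\<theta> t)) has_real_derivative p * cos (\<theta> t) - k * sin (\<theta> t)) (at t)"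
      and 2: "((\<lambda>t. r t * sin (\<theta> t)) has_real_derivative p * sin (\<theta> t) + k * cos (\<theta> t)) (at t)"
      by (rule derivative_eq_intros r d\<theta> t refl | use r0[OF t] in \<open>simp add: field_simps\<close>)+
    show ?thesis
      unfolding \<alpha>e
      by (rule derivative_eq_intros 1 2 z t refl)+ (simp add: T_def A_def B_def C_def algebra_simps)
  qed
  have "smooth_on \<alpha> J"
    using smooth_on_closed_form[OF J(1) r0 r d\<theta> d\<alpha>[unfolded T_def]] .
  \<comment> \<open>The horizontal part has squared length p^2 + k^2. Adding the axial part gives
    (a^2 + b^2) cos^2 \<psi> + sin^2 \<psi> = 1, where the sign \<epsilon> disappears on
    squaring.\<close>
  moreover have "norm (T t) = 1" for t
  proof -
    have "k\<^sup>2 = (sin \<psi>)\<^sup>2"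
      using \<epsilon> by (auto simp: k_def)
    moreover have "T t \<bullet> T t = (p\<^sup>2 + k\<^sup>2) * ((sin (\<theta> t))\<^sup>2 + (cos (\<theta> t))\<^sup>2) + (b * cos \<psi>)\<^sup>2"
      by (simp add: T_def A_def B_def C_def e_def inner_vec_def sum_3 axis_def)
        (use sin_cos_squared_add[of "\<theta> t"] in algebra)
    ultimately have "T t \<bullet> T t = (a\<^sup>2 + b\<^sup>2) * (cos \<psi>)\<^sup>2 + (sin \<psi>)\<^sup>2"
      by (simp add: p_def algebra_simps power_mult_distrib)
    then show ?thesis
      using ab by (simp add: norm_eq_sqrt_inner)
  qed
  \<comment> \<open>\<open>A\<close> and \<open>B\<close> are horizontal, so only \<open>C\<close>
    contributes to the product with the rotation axis.\<close>
  moreover have "norm (e 3) = 1" and "T t \<bullet> e 3 = b * cos \<psi>" for t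
    by (simp_all add: T_def A_def B_def C_def e_def inner_axis_axis inner_add_left inner_diff_left)
  moreover have "vector_derivative \<alpha> (at t) = T t" if "t \<in> J" for t
    using d\<alpha>[OF that] by (rule vector_derivative_at)
  ultimately show ?thesis
    unfolding general_helix_on_def by auto
qed

end
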